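(* Suppose that $\Gamma$ is a consistent set of s-formulas in $\mathcal{F}_1$, $\phi$ is an s-formula in $\mathcal{F}_1$, and every frame that satisfies $\Gamma$ satisfies $\phi$. Then there is a derivation of $\phi$ from $\Gamma$ using the rules (I), (HS), and (N) of the deductive system for $\mathcal{F}_1$.
   Context: Fix an infinite (possibly uncountable) set $\Sigma$ of propositional variables. The fragment $\mathcal{F}_1$ consists of all formal expressions (s-formulas) $X\prec Y$ (strict implication) and $X\not\prec Y$ (strict nonimplication), where $X$ and $Y$ are individual propositional variables; $\prec$ and $\not\prec$ are two formal symbols. A valuation is a function $w:\Sigma\to\{T,F\}$. A frame is a nonempty set of valuations. A frame $R$ satisfies $X \prec Y$ if for every $w\in R$, $w(X)=F$ or $w(Y)=T$. A frame $R$ satisfies $X\not\prec Y$ if there is some $w\in R$ with $w(X)=T$ and $w(Y)=F$. A frame satisfies a set $\Gamma$ of s-formulas if it satisfies every member. $\Gamma$ is consistent if some frame satisfies it. The deductive system for $\mathcal{F}_1$ consists of the following rule schemes, where $W,X,Y,Z$ range over arbitrary propositional variables: - (I) Deduce $X\prec X$ (no premises). - (HS) From $X\prec Y$ and $Y\prec Z$, deduce $X\prec Z$. - (N) From $X\not\prec Y$, $X\prec W$, and $Z\prec Y$, deduce $W\not\prec Z$. A derivation of $\phi$ from $\Gamma$ is a finite derivation of $\phi$ from members of $\Gamma$ using these rules. *)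

theory Defs
  imports Main
begin

text \<open>The type parameter \<open>'v\<close> is the set of propositional variables; that it is infinite is
  assumed where it is needed.\<close>

datatype 'v sform =
    SImp 'v 'v   (infix "\<prec>" 55)
  | SNImp 'v 'v  (infix "\<not>\<prec>" 55)

type_synonym 'v valuation = "'v \<Rightarrow> bool"

definition is_frame :: "'v valuation set \<Rightarrow> bool" where
  "is_frame R \<longleftrightarrow> R \<noteq> {}"

fun satisfies :: "'v valuation set \<Rightarrow> 'v sform \<Rightarrow> bool" where
  "satisfies R (X \<prec> Y) \<longleftrightarrow> (\<forall>w\<in>R. w X = False \<or> w Y = True)"
| "satisfies R (X \<not>\<prec> Y) \<longleftrightarrow> (\<exists>w\<in>R. w X = True \<and> w Y = False)"

definition satisfies_all :: "'v valuation set \<Rightarrow> 'v sform set \<Rightarrow> bool" where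
  "satisfies_all R \<Gamma> \<longleftrightarrow> (\<forall>\<psi>\<in>\<Gamma>. satisfies R \<psi>)"

definition consistent :: "'v sform set \<Rightarrow> bool" where
  "consistent \<Gamma> \<longleftrightarrow> (\<exists>R. is_frame R \<and> satisfies_all R \<Gamma>)"

text \<open>\<open>deduction_rule ps \<psi>\<close>: an instance of a rule scheme with premises \<open>ps\<close> and conclusion \<open>\<psi>\<close>.\<close>

inductive deduction_rule :: "'v sform list \<Rightarrow> 'v sform \<Rightarrow> bool" where
  I: "deduction_rule [] (X \<prec> X)"
| HS: "deduction_rule [X \<prec> Y, Y \<prec> Z] (X \<prec> Z)"
| N: "deduction_rule [X \<not>\<prec> Y, X \<prec> W, Z \<prec> Y] (W \<not>\<prec> Z)"

text \<open>A derivation is a finite sequence of s-formulas ending in the derived one; each entry is a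
  member of \<open>\<Gamma>\<close> or follows by a rule from strictly earlier entries.\<close>

definition is_derivation :: "'v sform set \<Rightarrow> 'v sform list \<Rightarrow> 'v sform \<Rightarrow> bool" where
  "is_derivation \<Gamma> ds \<phi> \<longleftrightarrow>
     ds \<noteq> [] \<and> last ds = \<phi> \<and>
     (\<forall>i<length ds. ds ! i \<in> \<Gamma> \<or>
        (\<exists>ps. set ps \<subseteq> set (take i ds) \<and> deduction_rule ps (ds ! i)))"

end

(* Order the variables by the reflexive-transitive closure of the strict implications in \<Gamma>.
   The frame of all up-closed valuations satisfies exactly the strict implications of this order,
   and by consistency also the nonimplications in \<Gamma>, so valid strict implications come from (I)
   and (HS). If A \<not>\<prec> B is valid, adding the edge (A, B) to the order must break some X \<not>\<prec> Y in \<Gamma>;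
   then X \<prec> A and B \<prec> Y are derivable, and (N) applies. *)

theory Submission
  imports Defs
begin

section \<open>Derivations\<close>

text \<open>Leaves out the demand of \<open>is_derivation\<close> on the last entry, so that the
  empty list qualifies and lists can be concatenated.\<close>

definition valid_steps :: "'v sform set \<Rightarrow> 'v sform list \<Rightarrow> bool" where
  "valid_steps \<Gamma> ds \<longleftrightarrow> (\<forall>i<length ds. ds ! i \<in> \<Gamma> \<or>
     (\<exists>ps. set ps \<subseteq> set (take i ds) \<and> deduction_rule ps (ds ! i)))"

definition derivable :: "'v sform set \<Rightarrow> 'v sform \<Rightarrow> bool" where
  "derivable \<Gamma> \<phi> \<longleftrightarrow> (\<exists>ds. is_derivation \<Gamma> ds \<phi>)"

lemma valid_steps_append:
  assumes "valid_steps \<Gamma> xs" and "valid_steps \<Gamma> ys"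
  shows "valid_steps \<Gamma> (xs @ ys)"
  unfolding valid_steps_def
proof (intro allI impI)
  fix i assume i: "i < length (xs @ ys)"
  show "(xs @ ys) ! i \<in> \<Gamma> \<or>
    (\<exists>ps. set ps \<subseteq> set (take i (xs @ ys)) \<and> deduction_rule ps ((xs @ ys) ! i))"
  proof (cases "i < length xs")
    case True
    then show ?thesis using assms(1) by (simp add: valid_steps_def nth_append)
  next
    case False
    then have "i - length xs < length ys" using i by simp
    then have "ys ! (i - length xs) \<in> \<Gamma> \<or>
      (\<exists>ps. set ps \<subseteq> set (take (i - length xs) ys) \<and> deduction_rule ps (ys ! (i - length xs)))"
      using assms(2) by (simp add: valid_steps_def)
    \<comment> \<open>The prefix of \<open>xs @ ys\<close> before \<open>i\<close> contains the
      corresponding prefix of \<open>ys\<close>, so the premises used inside \<open>ys\<close> are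
      still available.\<close>
    then show ?thesis using False by (auto simp: nth_append)
  qed
qed

lemma valid_steps_snoc:
  assumes "valid_steps \<Gamma> xs" and "\<phi> \<in> \<Gamma> \<or> (\<exists>ps. set ps \<subseteq> set xs \<and> deduction_rule ps \<phi>)"
  shows "valid_steps \<Gamma> (xs @ [\<phi>])"
  using assms by (auto simp: valid_steps_def nth_append less_Suc_eq)

lemma derivable_snoc:
  assumes "valid_steps \<Gamma> (xs @ [\<phi>])"
  shows "derivable \<Gamma> \<phi>"
  using assms unfolding derivable_def is_derivation_def valid_steps_def
  by (intro exI[of _ "xs @ [\<phi>]"]) simp

lemma derivable_member: "\<phi> \<in> \<Gamma> \<Longrightarrow> derivable \<Gamma> \<phi>"
  by (rule derivable_snoc[of _ "[]"], rule valid_steps_snoc) (simp_all add: valid_steps_def)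

text \<open>Concatenating one derivation per premise puts all premises into a single list, to which
  the conclusion of a rule can then be appended.\<close>

lemma valid_steps_covering:
  assumes "\<forall>\<psi>\<in>set ps. derivable \<Gamma> \<psi>"
  shows "\<exists>xs. valid_steps \<Gamma> xs \<and> set ps \<subseteq> set xs"
  using assms
proof (induction ps)
  case Nil
  have "valid_steps \<Gamma> []" by (simp add: valid_steps_def)
  then show ?case by auto
next
  case (Cons \<psi> ps)
  then obtain xs where xs: "valid_steps \<Gamma> xs" "set ps \<subseteq> set xs" by auto
  from Cons.prems obtain ds where "is_derivation \<Gamma> ds \<psi>" by (auto simp: derivable_def)
  then have "valid_steps \<Gamma> ds" "\<psi> \<in> set ds"
    by (auto simp: is_derivation_def valid_steps_def)
  then show ?case using xs valid_steps_append[of \<Gamma> ds xs] by (intro exI[of _ "ds @ xs"]) auto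
qed

lemma derivable_rule:
  assumes "deduction_rule ps \<phi>" and "\<forall>\<psi>\<in>set ps. derivable \<Gamma> \<psi>"
  shows "derivable \<Gamma> \<phi>"
proof -
  obtain xs where "valid_steps \<Gamma> xs" "set ps \<subseteq> set xs"
    using valid_steps_covering[OF assms(2)] by auto
  then show ?thesis using assms(1) by (intro derivable_snoc[of \<Gamma> xs] valid_steps_snoc) auto
qed

section \<open>Canonical frames\<close>

definition imp_edges :: "'v sform set \<Rightarrow> ('v \<times> 'v) set" where
  "imp_edges \<Gamma> = {(X, Y). X \<prec> Y \<in> \<Gamma>}"

text \<open>The up-sets of the preorder \<open>r\<^sup>*\<close>, as characteristic functions; this
  is the largest frame in which every edge of \<open>r\<close> holds as a strict
  implication.\<close>

definition upclosed_frame :: "('v \<times> 'v) set \<Rightarrow> 'v valuation set" where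
  "upclosed_frame r = {w. \<forall>(x, y)\<in>r. w x \<longrightarrow> w y}"

text \<open>Induction along the path: (I) yields the empty path and (HS) appends one edge.\<close>

lemma derivable_imp:
  assumes "(X, Y) \<in> (imp_edges \<Gamma>)\<^sup>*"
  shows "derivable \<Gamma> (X \<prec> Y)"
  using assms
proof (induction rule: rtrancl_induct)
  case base
  show ?case by (rule derivable_rule[OF I]) simp
next
  case (step Y Z)
  then show ?case
    by (intro derivable_rule[OF HS[of X Y Z]]) (auto simp: imp_edges_def intro: derivable_member)
qed

lemma is_frame_upclosed: "is_frame (upclosed_frame r)"
proof -
  have "(\<lambda>_. True) \<in> upclosed_frame r" by (auto simp: upclosed_frame_def)
  then show ?thesis by (auto simp: is_frame_def)
qed

lemma upclosed_rtrancl: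
  assumes "(X, Y) \<in> r\<^sup>*" and "w \<in> upclosed_frame r" and "w X"
  shows "w Y"
  using assms by (induction rule: rtrancl_induct) (auto simp: upclosed_frame_def)

text \<open>The principal up-set of \<open>X\<close> serves as a countermodel: it makes
  \<open>X\<close> true and every variable not reachable from \<open>X\<close> false.\<close>

lemma principal_upclosed: "(\<lambda>Y. (X, Y) \<in> r\<^sup>*) \<in> upclosed_frame r"
  by (auto simp: upclosed_frame_def intro: rtrancl_into_rtrancl)

lemma upclosed_satisfies_imp: "satisfies (upclosed_frame r) (X \<prec> Y) \<longleftrightarrow> (X, Y) \<in> r\<^sup>*"
proof
  assume "satisfies (upclosed_frame r) (X \<prec> Y)"
  then show "(X, Y) \<in> r\<^sup>*" using principal_upclosed[of X r] by fastforce
qed (auto intro: upclosed_rtrancl)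

lemma satisfies_nimp: "satisfies R (X \<not>\<prec> Y) \<longleftrightarrow> \<not> satisfies R (X \<prec> Y)"
  by auto

text \<open>Stated for any \<open>r\<close> extending the edges of \<Gamma>, since it is applied
  both to these edges alone and to them with one edge added.\<close>

lemma upclosed_satisfies_all:
  assumes "imp_edges \<Gamma> \<subseteq> r" and "\<And>X Y. X \<not>\<prec> Y \<in> \<Gamma> \<Longrightarrow> (X, Y) \<notin> r\<^sup>*"
  shows "satisfies_all (upclosed_frame r) \<Gamma>"
  unfolding satisfies_all_def
proof
  fix \<psi> assume "\<psi> \<in> \<Gamma>"
  then show "satisfies (upclosed_frame r) \<psi>"
    using assms
    by (cases \<psi>) (auto simp only: upclosed_satisfies_imp satisfies_nimp imp_edges_def)
qed

text \<open>Each valuation in a frame satisfying \<Gamma> respects all edges, hence all paths,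
  whereas a witness of \<open>X \<not>\<prec> Y\<close> would violate a path from \<open>X\<close>
  to \<open>Y\<close>.\<close>

lemma consistent_nimp:
  assumes "consistent \<Gamma>" and "X \<not>\<prec> Y \<in> \<Gamma>"
  shows "(X, Y) \<notin> (imp_edges \<Gamma>)\<^sup>*"
proof
  assume XY: "(X, Y) \<in> (imp_edges \<Gamma>)\<^sup>*"
  obtain R where R: "satisfies_all R \<Gamma>" using assms(1) by (auto simp: consistent_def)
  then obtain w where w: "w \<in> R" "w X" "\<not> w Y"
    using assms(2) by (fastforce simp: satisfies_all_def)
  have "w \<in> upclosed_frame (imp_edges \<Gamma>)"
    using R w(1) by (fastforce simp: upclosed_frame_def imp_edges_def satisfies_all_def)
  then show False using upclosed_rtrancl[OF XY] w by blast
qed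

theorem theorem20:
  fixes \<Gamma> :: "'v sform set" and \<phi> :: "'v sform"
  assumes "infinite (UNIV :: 'v set)"
    and "consistent \<Gamma>"
    and "\<And>R. is_frame R \<Longrightarrow> satisfies_all R \<Gamma> \<Longrightarrow> satisfies R \<phi>"
  shows "\<exists>ds. is_derivation \<Gamma> ds \<phi>"
proof -
  have "derivable \<Gamma> \<phi>"
  proof (cases \<phi>)
    case (SImp A B)
    have "satisfies_all (upclosed_frame (imp_edges \<Gamma>)) \<Gamma>"
      by (intro upclosed_satisfies_all consistent_nimp[OF assms(2)]) auto
    from assms(3)[OF is_frame_upclosed this] have "(A, B) \<in> (imp_edges \<Gamma>)\<^sup>*"
      unfolding SImp upclosed_satisfies_imp .
    then show ?thesis unfolding SImp by (rule derivable_imp)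
  next
    case (SNImp A B)
    let ?r = "insert (A, B) (imp_edges \<Gamma>)"
    \<comment> \<open>The new edge makes \<open>A \<prec> B\<close> true, so this frame refutes
      \<open>\<phi>\<close> and cannot satisfy \<Gamma>.\<close>
    have "satisfies (upclosed_frame ?r) (A \<prec> B)"
      unfolding upclosed_satisfies_imp by auto
    then have "\<not> satisfies_all (upclosed_frame ?r) \<Gamma>"
      using assms(3)[OF is_frame_upclosed, of ?r] unfolding SNImp satisfies_nimp by blast
    then obtain X Y where XY: "X \<not>\<prec> Y \<in> \<Gamma>" "(X, Y) \<in> ?r\<^sup>*"
      using upclosed_satisfies_all[of \<Gamma> ?r] by blast
    \<comment> \<open>By consistency no path from \<open>X\<close> to \<open>Y\<close> avoids the
      new edge, so \<open>rtrancl_insert\<close> splits the path into one from \<open>X\<close> to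
      \<open>A\<close> and one from \<open>B\<close> to \<open>Y\<close>.\<close>
    then have "(X, A) \<in> (imp_edges \<Gamma>)\<^sup>*" "(B, Y) \<in> (imp_edges \<Gamma>)\<^sup>*"
      using consistent_nimp[OF assms(2)] by (auto simp: rtrancl_insert)
    then show ?thesis
      unfolding SNImp using XY(1)
      by (intro derivable_rule[OF N[of X Y A B]]) (auto intro: derivable_imp derivable_member)
  qed
  then show ?thesis unfolding derivable_def .
qed

end
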